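(* For all positive integers $n$ and $k$, there exist a tree space $\mathcal{T}$ with at most $k$ leaves and a set $\mathcal{A}$ of at most $n$ paths in $\mathcal{T}$ such that every conflict-free coloring of $\mathcal{A}$ uses at least $\lfloor \log_2\min(k,n)\rfloor$ colors. In other words, $\chi^{\mathrm{CF}}_{\mathrm{tree}}(\mathrm{paths};k;n)\ge \lfloor\log_2\min(k,n)\rfloor$.
   Context: A network space is a 1-dimensional space with the topology of a graph (nodes are points, edges are simple curves joining pairs of nodes, otherwise disjoint); a tree space is a network space whose underlying graph is a tree. A path in a tree space is a connected subset homeomorphic to a (possibly degenerate) segment, i.e., a connected subset with at most two leaves. For a set $\mathcal{A}$ of objects and a point $p$, $S_p=\{o\in\mathcal{A}:p\in o\}$. A coloring of $\mathcal{A}$ is conflict-free if for every point $p$ with $S_p\ne\emptyset$, some object of $S_p$ has a color different from the colors of all other objects in $S_p$. $\chi^{\mathrm{CF}}_{\mathrm{tree}}(\mathrm{paths};k;n)$ is the minimum number of colors sufficient to CF-color any set of $n$ paths in any tree space with at most $k$ leaves. *)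

theory Defs
  imports "HOL-Analysis.Analysis"
begin

text \<open>
  A network space is given by a topology \<open>X\<close>, a finite set \<open>V\<close> of points of \<open>X\<close> (the nodes) and a
  finite set \<open>E\<close> of subsets of \<open>X\<close> (the edges). Each edge is a simple curve, and the nodes lying on
  it are precisely its two ends, so the end pair of an edge \<open>e\<close> in the underlying graph is
  \<open>e \<inter> V\<close>. Parallel edges are possible, loops are not. The last conjunct says that \<open>X\<close> carries the
  usual (weak) topology of a graph: openness is tested on the single edges.
\<close>

definition simple_curve_between :: "'a topology \<Rightarrow> 'a set \<Rightarrow> 'a \<Rightarrow> 'a \<Rightarrow> bool" where
  "simple_curve_between X e u v \<longleftrightarrow>
     e \<subseteq> topspace X \<and>
     (\<exists>f. homeomorphic_map (top_of_set {0..1::real}) (subtopology X e) f \<and> f 0 = u \<and> f 1 = v)"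

definition network_space :: "'a topology \<Rightarrow> 'a set \<Rightarrow> 'a set set \<Rightarrow> bool" where
  "network_space X V E \<longleftrightarrow>
     finite V \<and> finite E \<and> topspace X = V \<union> \<Union>E \<and>
     (\<forall>e\<in>E. \<exists>u v. simple_curve_between X e u v \<and> e \<inter> V = {u, v}) \<and>
     (\<forall>e\<in>E. \<forall>e'\<in>E. e \<noteq> e' \<longrightarrow> e \<inter> e' \<subseteq> V) \<and>
     (\<forall>U. openin X U \<longleftrightarrow>
        U \<subseteq> topspace X \<and> (\<forall>e\<in>E. openin (subtopology X e) (U \<inter> e)))"

definition graph_connected :: "'a set \<Rightarrow> 'a set set \<Rightarrow> bool" where
  "graph_connected V E \<longleftrightarrow>
     V \<noteq> {} \<and> (\<forall>u\<in>V. \<forall>v\<in>V. (u, v) \<in> {(x, y). \<exists>e\<in>E. e \<inter> V = {x, y}}\<^sup>*)"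

text \<open>
  A cycle visits distinct nodes \<open>vs\<close> along distinct edges \<open>es\<close>; two parallel edges form a cycle of
  length 2.
\<close>

definition graph_cycle :: "'a set \<Rightarrow> 'a set set \<Rightarrow> 'a list \<Rightarrow> 'a set list \<Rightarrow> bool" where
  "graph_cycle V E vs es \<longleftrightarrow>
     length vs \<ge> 2 \<and> length es = length vs \<and>
     distinct vs \<and> set vs \<subseteq> V \<and> distinct es \<and> set es \<subseteq> E \<and>
     (\<forall>i<length vs. es ! i \<inter> V = {vs ! i, vs ! (Suc i mod length vs)})"

definition graph_is_tree :: "'a set \<Rightarrow> 'a set set \<Rightarrow> bool" where
  "graph_is_tree V E \<longleftrightarrow> graph_connected V E \<and> (\<nexists>vs es. graph_cycle V E vs es)"

definition graph_leaves :: "'a set \<Rightarrow> 'a set set \<Rightarrow> 'a set" where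
  "graph_leaves V E = {v \<in> V. card {e \<in> E. v \<in> e} = 1}"

definition tree_space_leaves_le :: "'a topology \<Rightarrow> nat \<Rightarrow> bool" where
  "tree_space_leaves_le X k \<longleftrightarrow>
     (\<exists>V E. network_space X V E \<and> graph_is_tree V E \<and> card (graph_leaves V E) \<le> k)"

text \<open>The case \<open>a = b\<close> gives the degenerate, one-point paths.\<close>

definition tree_path :: "'a topology \<Rightarrow> 'a set \<Rightarrow> bool" where
  "tree_path X P \<longleftrightarrow>
     P \<subseteq> topspace X \<and>
     (\<exists>a b::real. a \<le> b \<and> subtopology X P homeomorphic_space top_of_set {a..b})"

definition objects_at :: "'a set set \<Rightarrow> 'a \<Rightarrow> 'a set set" where
  "objects_at \<A> p = {P \<in> \<A>. p \<in> P}"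

definition conflict_free :: "'a set set \<Rightarrow> ('a set \<Rightarrow> 'c) \<Rightarrow> bool" where
  "conflict_free \<A> col \<longleftrightarrow>
     (\<forall>p. objects_at \<A> p \<noteq> {} \<longrightarrow>
        (\<exists>P\<in>objects_at \<A> p. \<forall>Q\<in>objects_at \<A> p. Q \<noteq> P \<longrightarrow> col Q \<noteq> col P))"

text \<open>
  A tree space is a union of finitely many arcs and points, so it has at most continuum many points
  and is homeomorphic to a topology whose points are taken from \<^typ>\<open>real \<times> real\<close>. The
  topologies below are arbitrary topologies on subsets of this type, not necessarily subspaces of
  the Euclidean plane; thus every tree space occurs up to homeomorphism.
\<close>

definition cf_colors_suffice :: "nat \<Rightarrow> nat \<Rightarrow> nat \<Rightarrow> bool" where
  "cf_colors_suffice k n c \<longleftrightarrow>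
     (\<forall>(X :: (real \<times> real) topology) \<A>.
        tree_space_leaves_le X k \<and> finite \<A> \<and> card \<A> = n \<and> (\<forall>P\<in>\<A>. tree_path X P) \<longrightarrow>
        (\<exists>col :: (real \<times> real) set \<Rightarrow> nat. conflict_free \<A> col \<and> card (col ` \<A>) \<le> c))"

definition chi_CF_tree_paths :: "nat \<Rightarrow> nat \<Rightarrow> nat" where
  "chi_CF_tree_paths k n = (LEAST c. cf_colors_suffice k n c)"

lemma cf_colors_suffice_self: "cf_colors_suffice k n n"
  unfolding cf_colors_suffice_def
proof (intro allI impI, elim conjE)
  fix X :: "(real \<times> real) topology" and \<A> :: "(real \<times> real) set set"
  assume "finite \<A>" and n: "card \<A> = n"
  then obtain col :: "(real \<times> real) set \<Rightarrow> nat" where col: "inj_on col \<A>"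
    using finite_imp_inj_to_nat_seg by blast
  then have "conflict_free \<A> col"
    unfolding conflict_free_def objects_at_def by (auto dest: inj_onD)
  moreover have "card (col ` \<A>) \<le> n"
    using n by (simp add: card_image[OF col])
  ultimately show "\<exists>col :: (real \<times> real) set \<Rightarrow> nat. conflict_free \<A> col \<and> card (col ` \<A>) \<le> n"
    by blast
qed

lemma cf_colors_suffice_chi: "cf_colors_suffice k n (chi_CF_tree_paths k n)"
  unfolding chi_CF_tree_paths_def by (rule LeastI[of _ n], rule cf_colors_suffice_self)

end

theory Submission
  imports Defs
begin

text \<open>
  Draw the complete binary tree of depth \<open>d\<close>, with one more edge attached to its root, in the plane
  such that the root-to-leaf paths are graphs of functions over \<open>{1..d+1}\<close>, the \<open>x\<close>-coordinate
  being the depth, and let these \<open>2 ^ d\<close> paths be the objects. At the root some path has a unique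
  color; the child of the root that this path avoids is the root of a binary tree of depth \<open>d - 1\<close>,
  all of whose paths avoid this color. Iterating down to a leaf yields \<open>d + 1\<close> colors. Degenerate
  paths on the additional edge bring the number of objects up to \<open>n\<close> without affecting this argument.
\<close>

section \<open>Branches as piecewise linear functions that never meet again after separating\<close>

text \<open>The clamp lets an index \<open>i\<close> act only on \<open>{i..i+1}\<close>: a branch
  ignores it before depth \<open>i\<close> and keeps a constant offset after depth
  \<open>i+1\<close>.\<close>

definition ramp :: "real \<Rightarrow> real" where
  "ramp t = min 1 (max 0 t)"

text \<open>
  A finite set of naturals encodes a branch of the binary tree: the set records the depths at which
  the branch turns upwards.
\<close>

definition branch :: "nat set \<Rightarrow> real \<Rightarrow> real" where
  "branch w x = (\<Sum>i\<in>w. ramp (x - real i) / 2 ^ i)"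

definition branch_graph :: "nat set \<Rightarrow> real set \<Rightarrow> (real \<times> real) set" where
  "branch_graph w I = (\<lambda>x. (x, branch w x)) ` I"

lemma continuous_on_branch: "continuous_on S (branch w)"
  unfolding branch_def ramp_def by (intro continuous_intros) auto

text \<open>A finite tail of the geometric series stays strictly below its limit. This is why the
  weights \<open>1 / 2 ^ i\<close> let one upward turn outweigh all later ones.\<close>

lemma sum_inverse_powers_2_less:
  assumes "finite B" and "B \<subseteq> {j<..}"
  shows "(\<Sum>i\<in>B. 1 / 2 ^ i :: real) < 1 / 2 ^ j"
proof -
  \<comment> \<open>The gap \<open>1 / 2 ^ (j + m)\<close> left by the telescoped sum gives the
    strict inequality.\<close>
  have tele: "(\<Sum>i\<in>{j<..j + m}. 1 / 2 ^ i :: real) = 1 / 2 ^ j - 1 / 2 ^ (j + m)" for m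
  proof (induction m)
    case (Suc m)
    have "{j<..j + Suc m} = insert (j + Suc m) {j<..j + m}"
      by auto
    then have "(\<Sum>i\<in>{j<..j + Suc m}. 1 / 2 ^ i :: real)
        = 1 / 2 ^ (j + Suc m) + (\<Sum>i\<in>{j<..j + m}. 1 / 2 ^ i)"
      by simp
    then show ?case
      unfolding Suc.IH by (simp add: field_simps)
  qed simp
  obtain m where "\<forall>i\<in>B. i < m"
    using assms(1) finite_nat_set_iff_bounded by blast
  then have "B \<subseteq> {j<..j + m}"
    using assms(2) by fastforce
  then have "(\<Sum>i\<in>B. 1 / 2 ^ i :: real) \<le> (\<Sum>i\<in>{j<..j + m}. 1 / 2 ^ i)"
    by (intro sum_mono2) auto
  also have "\<dots> < 1 / 2 ^ j"
    unfolding tele by simp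
  finally show ?thesis .
qed

text \<open>The first difference decides the order: each \<open>i > j\<close> satisfies
  \<open>ramp (x - i) <= ramp (x - j)\<close>, so the later turns of \<open>v\<close> together stay
  below the single contribution of \<open>j\<close> to \<open>w\<close>.\<close>

lemma branch_less:
  assumes fin: "finite w" "finite v" and j: "j \<in> w" "j \<notin> v" "real j < x"
    and below: "\<And>i. i < j \<Longrightarrow> i \<in> w \<longleftrightarrow> i \<in> v"
  shows "branch v x < branch w x"
proof -
  define t where "t i = ramp (x - real i) / 2 ^ i" for i
  define A where "A = {i \<in> v. i < j}"
  define B where "B = {i \<in> v. j < i}"
  have fAB: "finite A" "finite B"
    using fin by (auto simp: A_def B_def)
  have AB: "v = A \<union> B" "A \<inter> B = {}"
    using j(2) by (auto simp: A_def B_def) (metis linorder_neqE_nat)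
  have v: "branch v x = sum t A + sum t B"
    unfolding branch_def t_def[symmetric] AB(1) using sum.union_disjoint[OF fAB AB(2)] .
  \<comment> \<open>The elements of \<open>w\<close> above \<open>j\<close> contribute non-negative
    terms and are dropped; those below \<open>j\<close> form \<open>A\<close>, as for
    \<open>v\<close>.\<close>
  have "sum t (insert j A) \<le> sum t w"
    using fin j below by (intro sum_mono2) (auto simp: A_def t_def ramp_def)
  then have w: "sum t A + t j \<le> branch w x"
    using fAB by (simp add: branch_def t_def[symmetric] A_def)
  have pos: "ramp (x - real j) > 0"
    using j by (simp add: ramp_def)
  have "sum t B \<le> (\<Sum>i\<in>B. ramp (x - real j) * (1 / 2 ^ i))"
    by (intro sum_mono) (auto simp: t_def B_def ramp_def divide_right_mono)
  also have "\<dots> = ramp (x - real j) * (\<Sum>i\<in>B. 1 / 2 ^ i)"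
    by (simp add: sum_distrib_left)
  also have "\<dots> < ramp (x - real j) * (1 / 2 ^ j)"
    using pos sum_inverse_powers_2_less[of B j] fAB by (intro mult_strict_left_mono) (auto simp: B_def)
  finally show ?thesis
    using v w by (simp add: t_def)
qed

text \<open>The drawing has no accidental crossings, so incidence questions about points of the
  plane reduce to comparing initial segments of sets.\<close>

lemma branch_eq_iff:
  assumes fin: "finite w" "finite v"
  shows "branch w x = branch v x \<longleftrightarrow> (\<forall>i. real i < x \<longrightarrow> (i \<in> w \<longleftrightarrow> i \<in> v))"
proof
  assume eq: "branch w x = branch v x"
  show "\<forall>i. real i < x \<longrightarrow> (i \<in> w \<longleftrightarrow> i \<in> v)"
  proof (intro allI)
    fix i
    show "real i < x \<longrightarrow> (i \<in> w \<longleftrightarrow> i \<in> v)"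
    proof (induction i rule: less_induct)
      case (less i)
      \<comment> \<open>By the induction hypothesis \<open>i\<close> could only be the first
        difference, and \<open>branch_less\<close> would then separate the two values in one
        direction or the other.\<close>
      then have below: "i' \<in> w \<longleftrightarrow> i' \<in> v" if "real i < x" "i' < i" for i'
        using that by force
      then show ?case
        using branch_less[of w v i x] branch_less[of v w i x] fin eq by fastforce
    qed
  qed
next
  assume agree: "\<forall>i. real i < x \<longrightarrow> (i \<in> w \<longleftrightarrow> i \<in> v)"
  \<comment> \<open>An index that is at least \<open>x\<close> has \<open>ramp\<close> value
    0.\<close>
  have restr: "branch u x = (\<Sum>i\<in>{i \<in> u. real i < x}. ramp (x - real i) / 2 ^ i)" if "finite u" for u
    unfolding branch_def using that by (intro sum.mono_neutral_right) (auto simp: ramp_def)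
  have "{i \<in> w. real i < x} = {i \<in> v. real i < x}"
    using agree by auto
  then show "branch w x = branch v x"
    using restr fin by simp
qed

lemma homeomorphism_imp_homeomorphic_maps:
  "homeomorphism S T f g \<Longrightarrow> homeomorphic_maps (top_of_set S) (top_of_set T) f g"
  by (auto simp: homeomorphism_def homeomorphic_maps_def continuous_map_subtopology_eu)

lemma homeomorphism_branch_graph:
  "homeomorphism I (branch_graph w I) (\<lambda>x. (x, branch w x)) fst"
  unfolding homeomorphism_def branch_graph_def
  by (auto intro!: continuous_intros continuous_on_branch simp: image_image)

section \<open>The drawn tree as a network space\<close>

definition node :: "nat set \<Rightarrow> nat \<Rightarrow> real \<times> real" where
  "node w i = (real i, branch w (real i))"

definition edge :: "nat set \<Rightarrow> nat \<Rightarrow> (real \<times> real) set" where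
  "edge w i = branch_graph w {real i..real (Suc i)}"

text \<open>Index 0 is excluded from \<open>w\<close>, so all branches coincide over
  \<open>{0..1}\<close>: this is the additional edge. The root of the binary tree has depth 1 and
  its leaves have depth \<open>Suc d\<close>. Different \<open>w\<close> may give the same node or
  edge.\<close>

definition nodes :: "nat \<Rightarrow> (real \<times> real) set" where
  "nodes d = {node w i |w i. w \<subseteq> {1..d} \<and> i \<le> Suc d}"

definition edges :: "nat \<Rightarrow> (real \<times> real) set set" where
  "edges d = {edge w i |w i. w \<subseteq> {1..d} \<and> i \<le> d}"

definition tree_top :: "nat \<Rightarrow> (real \<times> real) topology" where
  "tree_top d = top_of_set (\<Union> (edges d))"

lemma finite_nodes: "finite (nodes d)"
proof -
  have "nodes d = (\<lambda>(w, i). node w i) ` (Pow {1..d} \<times> {..Suc d})"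
    by (auto simp: nodes_def)
  then show ?thesis
    by simp
qed

lemma finite_edges: "finite (edges d)"
proof -
  have "edges d = (\<lambda>(w, i). edge w i) ` (Pow {1..d} \<times> {..d})"
    by (auto simp: edges_def)
  then show ?thesis
    by simp
qed

lemma node_in_nodes: "w \<subseteq> {1..d} \<Longrightarrow> i \<le> Suc d \<Longrightarrow> node w i \<in> nodes d"
  by (auto simp: nodes_def simp del: One_nat_def)

lemma edge_in_edges: "w \<subseteq> {1..d} \<Longrightarrow> i \<le> d \<Longrightarrow> edge w i \<in> edges d"
  by (auto simp: edges_def simp del: One_nat_def)

lemma finite_branch: "w \<subseteq> {1..d} \<Longrightarrow> finite w" for w :: "nat set"
  using finite_subset by blast

lemma node_eq_iff:
  assumes "finite w" "finite v"
  shows "node w i = node v j \<longleftrightarrow> i = j \<and> (\<forall>l<i. l \<in> w \<longleftrightarrow> l \<in> v)"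
  using branch_eq_iff[OF assms] by (auto simp: node_def)

text \<open>Points of the edge have first coordinate at most \<open>Suc i\<close>, so only indices
  up to \<open>i\<close> have started to act there.\<close>

lemma edge_eqI:
  assumes "finite w" "finite v" and "\<And>l. l \<le> i \<Longrightarrow> l \<in> w \<longleftrightarrow> l \<in> v"
  shows "edge w i = edge v i"
  unfolding edge_def branch_graph_def
proof (rule image_cong[OF refl])
  fix x assume x: "x \<in> {real i..real (Suc i)}"
  have "l \<in> w \<longleftrightarrow> l \<in> v" if "real l < x" for l
    using assms(3)[of l] that x by auto
  then show "(x, branch w x) = (x, branch v x)"
    using branch_eq_iff[OF assms(1,2)] by auto
qed

text \<open>Nodes have integral first coordinates, and an edge is the graph of a function over an
  interval between consecutive integers.\<close>

lemma edge_Int_nodes: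
  assumes "w \<subseteq> {1..d}" "i \<le> d"
  shows "edge w i \<inter> nodes d = {node w i, node w (Suc i)}"
proof
  show "edge w i \<inter> nodes d \<subseteq> {node w i, node w (Suc i)}"
  proof
    fix p assume "p \<in> edge w i \<inter> nodes d"
    then obtain v j x where p: "p = node v j" "p = (x, branch w x)"
        and x: "real i \<le> x" "x \<le> real (Suc i)"
      by (auto simp: edge_def branch_graph_def nodes_def)
    then have "x = real j"
      by (simp add: node_def)
    moreover from this have "j = i \<or> j = Suc i"
      using x by linarith
    ultimately show "p \<in> {node w i, node w (Suc i)}"
      using p by (auto simp: node_def)
  qed
  show "{node w i, node w (Suc i)} \<subseteq> edge w i \<inter> nodes d"
    using assms node_in_nodes[of w d i] node_in_nodes[of w d "Suc i"]
    by (auto simp: edge_def branch_graph_def node_def)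
qed

lemma topspace_tree_top: "topspace (tree_top d) = nodes d \<union> \<Union> (edges d)"
proof -
  have "nodes d \<subseteq> \<Union> (edges d)"
  proof
    fix p assume "p \<in> nodes d"
    then obtain w i where w: "w \<subseteq> {1..d}" "i \<le> Suc d" "p = node w i"
      by (auto simp: nodes_def)
    \<comment> \<open>For \<open>i = 0\<close> truncated subtraction gives \<open>edge w 0\<close>,
      which has the node as its left end.\<close>
    then have "p \<in> edge w (i - 1)"
      by (cases i) (auto simp: node_def edge_def branch_graph_def)
    moreover have "edge w (i - 1) \<in> edges d"
      using w by (intro edge_in_edges) auto
    ultimately show "p \<in> \<Union> (edges d)"
      by blast
  qed
  then show ?thesis
    by (auto simp: tree_top_def)
qed

lemma subtopology_tree_top:
  "S \<subseteq> \<Union> (edges d) \<Longrightarrow> subtopology (tree_top d) S = top_of_set S"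
  by (simp add: tree_top_def subtopology_subtopology Int_absorb1)

lemma branch_graph_subset:
  assumes w: "w \<subseteq> {1..d}"
  shows "branch_graph w {0..real (Suc d)} \<subseteq> \<Union> (edges d)"
proof
  fix p assume "p \<in> branch_graph w {0..real (Suc d)}"
  then obtain x where x: "p = (x, branch w x)" "0 \<le> x" "x \<le> real (Suc d)"
    by (auto simp: branch_graph_def)
  \<comment> \<open>The minimum matters at the right end \<open>x = Suc d\<close>, which belongs to
    the last edge, of index \<open>d\<close>.\<close>
  define i where "i = min d (nat \<lfloor>x\<rfloor>)"
  have "real i \<le> x" "x \<le> real (Suc i)"
    using x unfolding i_def by linarith+
  then have "p \<in> edge w i"
    using x by (auto simp: edge_def branch_graph_def)
  moreover have "edge w i \<in> edges d"
    using w by (intro edge_in_edges) (auto simp: i_def)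
  ultimately show "p \<in> \<Union> (edges d)"
    by blast
qed

lemma simple_curve_between_edge:
  assumes "w \<subseteq> {1..d}" "i \<le> d"
  shows "simple_curve_between (tree_top d) (edge w i) (node w i) (node w (Suc i))"
proof -
  have e: "edge w i \<subseteq> \<Union> (edges d)"
    using edge_in_edges[OF assms] by blast
  define f where "f t = (real i + t, branch w (real i + t))" for t
  have f: "f ` {0..1} = edge w i"
  proof -
    have "{real i..real (Suc i)} = (\<lambda>t. real i + t) ` {0..1}"
      by simp
    then show ?thesis
      by (simp add: edge_def branch_graph_def f_def image_image del: image_add_atLeastAtMost)
  qed
  have "homeomorphism {0..1} (edge w i) f (\<lambda>p. fst p - real i)"
    unfolding homeomorphism_def
  proof (intro conjI)
    show "continuous_on {0..1} f"
      unfolding f_def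
      by (intro continuous_intros continuous_on_compose2[OF continuous_on_branch[of UNIV]]) auto
    show "continuous_on (edge w i) (\<lambda>p. fst p - real i)"
      by (intro continuous_intros)
    show "(\<lambda>p. fst p - real i) ` edge w i = {0..1}"
      unfolding f[symmetric] by (simp add: f_def image_image)
    show "\<forall>p\<in>edge w i. f (fst p - real i) = p"
      unfolding f[symmetric] by (auto simp: f_def)
  qed (use f in \<open>auto simp: f_def\<close>)
  then have "homeomorphic_map (top_of_set {0..1}) (top_of_set (edge w i)) f"
    using homeomorphism_imp_homeomorphic_maps homeomorphic_map_maps by blast
  then show ?thesis
    using e subtopology_tree_top[OF e] topspace_tree_top
    by (auto simp: simple_curve_between_def node_def f_def add.commute intro!: exI[of _ f])
qed

text \<open>A common point strictly inside the first edge forces equal depths; it also lies beyond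
  every index up to that depth, so \<open>branch_eq_iff\<close> makes the two edges
  coincide.\<close>

lemma edges_Int_subset_nodes:
  assumes w: "w \<subseteq> {1..d}" "i \<le> d" and v: "v \<subseteq> {1..d}" "j \<le> d" and ne: "edge w i \<noteq> edge v j"
  shows "edge w i \<inter> edge v j \<subseteq> nodes d"
proof
  fix p assume "p \<in> edge w i \<inter> edge v j"
  then obtain x where p: "p = (x, branch w x)" and eq: "branch w x = branch v x"
    and x: "real i \<le> x" "x \<le> real (Suc i)" "real j \<le> x" "x \<le> real (Suc j)"
    by (auto simp: edge_def branch_graph_def)
  have "x = real i \<or> x = real (Suc i)"
  proof (rule ccontr)
    assume *: "\<not> ?thesis"
    then have "i = j"
      using x by auto
    moreover have "edge w i = edge v i"
    proof (rule edge_eqI)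
      fix l assume "l \<le> i"
      then have "real l < x"
        using * x by auto
      then show "l \<in> w \<longleftrightarrow> l \<in> v"
        using eq branch_eq_iff[of w v x] w v finite_branch by blast
    qed (use w v finite_branch in blast)+
    ultimately show False
      using ne by simp
  qed
  then have "p = node w i \<or> p = node w (Suc i)"
    using p by (auto simp: node_def)
  then show "p \<in> nodes d"
    using w node_in_nodes by auto
qed

lemma compact_edge: "compact (edge w i)"
  unfolding edge_def branch_graph_def
  by (intro compact_continuous_image continuous_intros continuous_on_branch compact_Icc)

lemma network_space_tree: "network_space (tree_top d) (nodes d) (edges d)"
  unfolding network_space_def
proof (intro conjI ballI impI allI)
  fix e assume "e \<in> edges d"
  then obtain w i where "w \<subseteq> {1..d}" "i \<le> d" "e = edge w i"
    by (auto simp: edges_def)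
  then show "\<exists>u v. simple_curve_between (tree_top d) e u v \<and> e \<inter> nodes d = {u, v}"
    using simple_curve_between_edge edge_Int_nodes by blast
next
  fix e e' assume "e \<in> edges d" "e' \<in> edges d" "e \<noteq> e'"
  then show "e \<inter> e' \<subseteq> nodes d"
    using edges_Int_subset_nodes unfolding edges_def by blast
next
  fix U
  let ?S = "\<Union> (edges d)"
  show "openin (tree_top d) U \<longleftrightarrow>
    U \<subseteq> topspace (tree_top d) \<and> (\<forall>e\<in>edges d. openin (subtopology (tree_top d) e) (U \<inter> e))"
  proof (intro iffI conjI ballI)
    assume U: "U \<subseteq> topspace (tree_top d) \<and>
      (\<forall>e\<in>edges d. openin (subtopology (tree_top d) e) (U \<inter> e))"
    \<comment> \<open>The weak topology is checked on complements: each edge is compact, so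
      \<open>e - U\<close> is closed in the plane, and finitely many such sets have a closed
      union.\<close>
    have "closed (e - U)" if e: "e \<in> edges d" for e
    proof -
      have "subtopology (tree_top d) e = top_of_set e"
        using e by (intro subtopology_tree_top) auto
      then have "openin (top_of_set e) (U \<inter> e)"
        using U e by force
      then have "closedin (top_of_set e) (e - U \<inter> e)"
        by (intro closedin_diff) auto
      moreover have "closed e"
        using e compact_edge compact_imp_closed by (auto simp: edges_def)
      ultimately have "closed (e - U \<inter> e)"
        by (rule closedin_closed_trans)
      moreover have "e - U \<inter> e = e - U"
        by blast
      ultimately show ?thesis
        by simp
    qed
    then have "closed (\<Union>e\<in>edges d. e - U)"
      using finite_edges by blast
    moreover have "(\<Union>e\<in>edges d. e - U) = ?S - U"
      by auto
    ultimately have "closedin (top_of_set ?S) (?S - U)"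
      by (metis Diff_subset closed_subset)
    then show "openin (tree_top d) U"
      using U by (auto simp: tree_top_def openin_closedin_eq)
  qed (auto simp: openin_subset openin_subtopology_Int)
qed (simp_all add: finite_nodes finite_edges topspace_tree_top)

section \<open>Connectedness, acyclicity and number of leaves of the underlying graph\<close>

text \<open>Every node descends edge by edge to the common end \<open>node {} 0\<close>, and
  adjacency is symmetric.\<close>

lemma graph_connected_tree: "graph_connected (nodes d) (edges d)"
  unfolding graph_connected_def
proof (intro conjI ballI)
  show "nodes d \<noteq> {}"
    using node_in_nodes[of "{}" d 0] by auto
  let ?R = "{(x, y). \<exists>e\<in>edges d. e \<inter> nodes d = {x, y}}"
  have "sym ?R"
    by (auto simp: sym_def insert_commute)
  then have sym: "sym (?R\<^sup>*)"
    by (rule sym_rtrancl)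
  have root: "(node w i, node {} 0) \<in> ?R\<^sup>*" if "w \<subseteq> {1..d}" "i \<le> Suc d" for w i
    using that
  proof (induction i)
    case 0
    have "node w 0 = node {} 0"
      using 0 finite_branch[of w d] by (simp add: node_eq_iff)
    then show ?case
      by simp
  next
    case (Suc i)
    have "edge w i \<in> edges d"
      using Suc by (intro edge_in_edges) auto
    moreover have "edge w i \<inter> nodes d = {node w (Suc i), node w i}"
      using Suc edge_Int_nodes[of w d i] by auto
    ultimately have "(node w (Suc i), node w i) \<in> ?R"
      by blast
    then show ?case
      using Suc by (auto intro: converse_rtrancl_into_rtrancl)
  qed
  fix u v assume "u \<in> nodes d" "v \<in> nodes d"
  then have "(u, node {} 0) \<in> ?R\<^sup>*" "(v, node {} 0) \<in> ?R\<^sup>*"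
    using root by (auto simp: nodes_def)
  then show "(u, v) \<in> ?R\<^sup>*"
    using sym by (meson rtrancl_trans symE)
qed

text \<open>A node of maximal depth on a cycle would have two edges towards the root.\<close>

lemma no_graph_cycle: "\<not> graph_cycle (nodes d) (edges d) vs es"
proof
  assume cyc: "graph_cycle (nodes d) (edges d) vs es"
  let ?n = "length vs"
  have n: "?n \<ge> 2" "length es = ?n" and dist: "distinct es"
    and es: "set es \<subseteq> edges d"
    and ends: "\<And>i. i < ?n \<Longrightarrow> es ! i \<inter> nodes d = {vs ! i, vs ! (Suc i mod ?n)}"
    using cyc by (auto simp: graph_cycle_def)
  define M where "M = Max ((\<lambda>i. fst (vs ! i)) ` {..<?n})"
  have "M \<in> (\<lambda>i. fst (vs ! i)) ` {..<?n}"
    unfolding M_def using n by (intro Max_in) (auto simp: lessThan_empty_iff)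
  then obtain i where i: "i < ?n" "fst (vs ! i) = M"
    by auto
  have le: "fst (vs ! j) \<le> M" if "j < ?n" for j
    unfolding M_def using that by (intro Max_ge) auto
  \<comment> \<open>The cyclic predecessor of \<open>i\<close>; the edges \<open>es ! i'\<close> and
    \<open>es ! i\<close> are the two that meet at \<open>vs ! i\<close>.\<close>
  define i' where "i' = (if i = 0 then ?n - 1 else i - 1)"
  have i': "i' < ?n" "Suc i' mod ?n = i" "i' \<noteq> i"
    using i n by (auto simp: i'_def)
  \<comment> \<open>The ends of an edge have different depths, so by maximality
    \<open>vs ! i\<close> is the deeper one.\<close>
  have down: "\<exists>w j. w \<subseteq> {1..d} \<and> e = edge w j \<and> node w (Suc j) = vs ! i"
    if "e \<in> set es" and e: "e \<inter> nodes d = {vs ! i, vs ! l}" "l < ?n" for e l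
  proof -
    have "e \<in> edges d"
      using that(1) es by blast
    then obtain w j where w: "w \<subseteq> {1..d}" "j \<le> d" "e = edge w j"
      by (auto simp: edges_def)
    then have "{node w j, node w (Suc j)} = {vs ! i, vs ! l}"
      using e edge_Int_nodes by simp
    moreover have "fst (node w j) < fst (node w (Suc j))"
      by (simp add: node_def)
    ultimately have "node w (Suc j) = vs ! i"
      using le[OF e(2)] i by (auto simp: doubleton_eq_iff)
    then show ?thesis
      using w by blast
  qed
  have "Suc i mod ?n < ?n"
    using n by (intro mod_less_divisor) auto
  then obtain w j where w: "w \<subseteq> {1..d}" "es ! i = edge w j" "node w (Suc j) = vs ! i"
    using down[of "es ! i"] ends[OF i(1)] i n by (metis nth_mem)
  obtain v l where v: "v \<subseteq> {1..d}" "es ! i' = edge v l" "node v (Suc l) = vs ! i"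
    using down[of "es ! i'" i'] ends[OF i'(1)] i' n by (metis insert_commute nth_mem)
  have fin: "finite w" "finite v"
    using w v finite_branch by blast+
  \<comment> \<open>A node fixes its depth and all indices below it, hence the edge leading down to
    it.\<close>
  have "j = l" and "\<And>m. m \<le> j \<Longrightarrow> m \<in> w \<longleftrightarrow> m \<in> v"
    using w(3) v(3) node_eq_iff[OF fin, of "Suc j" "Suc l"] by auto
  then have "es ! i = es ! i'"
    using edge_eqI[OF fin, of j] w v by simp
  then show False
    using dist i i' n by (simp add: nth_eq_iff_index_eq)
qed

text \<open>Only the bottom end and the \<open>2 ^ d\<close> top nodes can be leaves, since any
  other node lies on the edges below and above it; moreover
  \<open>2 ^ d + 1 <= 2 ^ Suc d\<close>.\<close>

lemma card_graph_leaves: "card (graph_leaves (nodes d) (edges d)) \<le> 2 ^ Suc d"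
proof -
  have "graph_leaves (nodes d) (edges d) \<subseteq> insert (node {} 0) ((\<lambda>w. node w (Suc d)) ` Pow {1..d})"
  proof
    fix p assume p: "p \<in> graph_leaves (nodes d) (edges d)"
    then obtain w i where w: "w \<subseteq> {1..d}" "i \<le> Suc d" "p = node w i"
      by (auto simp: graph_leaves_def nodes_def)
    have fin: "finite w"
      using w finite_branch by blast
    consider "i = 0" | "i = Suc d" | j where "i = Suc j" "j < d"
      using w by (cases i) force+
    then show "p \<in> insert (node {} 0) ((\<lambda>w. node w (Suc d)) ` Pow {1..d})"
    proof cases
      case 1
      then have "p = node {} 0"
        using w node_eq_iff[OF fin, of "{}"] by simp
      then show ?thesis
        by simp
    next
      case 2
      then show ?thesis
        using w by auto
    next
      case 3
      have "card {e \<in> edges d. p \<in> e} = 1"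
        using p by (simp add: graph_leaves_def)
      then obtain e where e: "{e \<in> edges d. p \<in> e} = {e}"
        by (auto simp: card_1_singleton_iff)
      have "edge w j \<in> edges d" "edge w (Suc j) \<in> edges d"
        using 3 w by (simp_all add: edge_in_edges del: One_nat_def)
      moreover have "p \<in> edge w j" "p \<in> edge w (Suc j)"
        using 3 w by (auto simp: edge_def branch_graph_def node_def)
      ultimately have "edge w j \<in> {e \<in> edges d. p \<in> e}" "edge w (Suc j) \<in> {e \<in> edges d. p \<in> e}"
        by simp_all
      then have "edge w j = edge w (Suc j)"
        unfolding e by simp
      \<comment> \<open>The two edges differ because they project to different intervals.\<close>
      then have "fst ` edge w j = fst ` edge w (Suc j)"
        by simp
      then have "{real j..real (Suc j)} = {real (Suc j)..real (Suc (Suc j))}"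
        by (simp add: edge_def branch_graph_def image_image)
      then show ?thesis
        by (simp add: Icc_eq_Icc)
    qed
  qed
  then have "card (graph_leaves (nodes d) (edges d))
      \<le> card (insert (node {} 0) ((\<lambda>w. node w (Suc d)) ` Pow {1..d}))"
    by (intro card_mono) auto
  also have "\<dots> \<le> Suc (card ((\<lambda>w. node w (Suc d)) ` Pow {1..d}))"
    by (rule card_insert_le_m1) auto
  also have "\<dots> \<le> Suc (2 ^ d)"
    using card_image_le[of "Pow {1..d}" "\<lambda>w. node w (Suc d)"] by (simp add: card_Pow)
  also have "\<dots> \<le> 2 ^ Suc d"
    using one_le_power[of "2::nat" d] by simp
  finally show ?thesis .
qed

lemma tree_space_leaves_le_tree: "2 ^ Suc d \<le> k \<Longrightarrow> tree_space_leaves_le (tree_top d) k"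
  using network_space_tree graph_connected_tree no_graph_cycle card_graph_leaves
  unfolding tree_space_leaves_le_def graph_is_tree_def by (meson order_trans)

section \<open>The paths and the number of colors they force\<close>

lemma tree_path_branch_graph:
  assumes "w \<subseteq> {1..d}" "0 \<le> a" "a \<le> b" "b \<le> real (Suc d)"
  shows "tree_path (tree_top d) (branch_graph w {a..b})"
proof -
  have "branch_graph w {a..b} \<subseteq> branch_graph w {0..real (Suc d)}"
    using assms by (auto simp: branch_graph_def)
  then have sub: "branch_graph w {a..b} \<subseteq> \<Union> (edges d)"
    using branch_graph_subset[OF assms(1)] by blast
  have "top_of_set (branch_graph w {a..b}) homeomorphic_space top_of_set {a..b}"
    using homeomorphism_imp_homeomorphic_maps[OF homeomorphism_branch_graph[of "{a..b}" w]]
    by (metis homeomorphic_space_def homeomorphic_space_sym)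
  then show ?thesis
    using sub assms(3) subtopology_tree_top[OF sub] topspace_tree_top[of d]
    by (auto simp: tree_path_def)
qed

text \<open>Starting at depth 1 keeps the additional edge, apart from its upper end, free for
  padding objects.\<close>

definition root_leaf_path :: "nat \<Rightarrow> nat set \<Rightarrow> (real \<times> real) set" where
  "root_leaf_path d w = branch_graph w {1..real (Suc d)}"

lemma node_in_root_leaf_path_iff:
  assumes "finite w" "finite v" "1 \<le> i" "i \<le> Suc d"
  shows "node w i \<in> root_leaf_path d v \<longleftrightarrow> (\<forall>l<i. l \<in> w \<longleftrightarrow> l \<in> v)"
proof -
  have "node w i \<in> root_leaf_path d v \<longleftrightarrow> node w i = node v i"
    using assms by (auto simp: node_def root_leaf_path_def branch_graph_def)
  then show ?thesis
    using node_eq_iff assms by simp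
qed

text \<open>The leaf at depth \<open>Suc d\<close> lies beyond every possible index and so
  determines the whole set.\<close>

lemma inj_on_root_leaf_path: "inj_on (root_leaf_path d) (Pow {1..d})"
proof (rule inj_onI)
  fix w v assume wv: "w \<in> Pow {1..d}" "v \<in> Pow {1..d}" and eq: "root_leaf_path d w = root_leaf_path d v"
  have fin: "finite w" "finite v"
    using wv finite_branch by blast+
  have "node w (Suc d) \<in> root_leaf_path d w"
    using fin by (simp add: node_in_root_leaf_path_iff)
  then have "\<forall>l<Suc d. l \<in> w \<longleftrightarrow> l \<in> v"
    using fin by (simp add: eq node_in_root_leaf_path_iff)
  moreover have "l < Suc d" if "l \<in> w \<or> l \<in> v" for l
    using wv that by auto
  ultimately show "w = v"
    by blast
qed

lemma conflict_free_colors: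
  fixes col :: "(real \<times> real) set \<Rightarrow> 'c"
  assumes cf: "conflict_free (root_leaf_path d ` Pow {1..d} \<union> \<B>) col"
    and \<B>: "\<And>Q p. Q \<in> \<B> \<Longrightarrow> p \<in> Q \<Longrightarrow> fst p < 1"
  shows "Suc d \<le> card (col ` root_leaf_path d ` Pow {1..d})"
proof -
  let ?C = "col ` root_leaf_path d ` Pow {1..d}"
  \<comment> \<open>Invariant of the descent: \<open>C\<close> holds \<open>j\<close> colors, and
    every root-to-leaf path through \<open>node w (Suc j)\<close> avoids them.\<close>
  have step: "\<exists>w C. w \<subseteq> {1..d} \<and> C \<subseteq> ?C \<and> card C = j \<and>
      (\<forall>v. v \<subseteq> {1..d} \<and> (\<forall>l<Suc j. l \<in> w \<longleftrightarrow> l \<in> v) \<longrightarrow> col (root_leaf_path d v) \<notin> C)"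
    if "j \<le> d" for j
    using that
  proof (induction j)
    case 0
    then show ?case
      by (intro exI[of _ "{}"]) auto
  next
    case (Suc j)
    then obtain w C where w: "w \<subseteq> {1..d}" and C: "C \<subseteq> ?C" "card C = j"
      and avoid: "\<And>v. v \<subseteq> {1..d} \<Longrightarrow> (\<And>l. l < Suc j \<Longrightarrow> l \<in> w \<longleftrightarrow> l \<in> v)
        \<Longrightarrow> col (root_leaf_path d v) \<notin> C"
      by (metis Suc_leD)
    let ?A = "objects_at (root_leaf_path d ` Pow {1..d} \<union> \<B>) (node w (Suc j))"
    have obj: "root_leaf_path d v \<in> ?A" if "v \<subseteq> {1..d}" "\<And>l. l < Suc j \<Longrightarrow> l \<in> w \<longleftrightarrow> l \<in> v" for v
      using that Suc.prems w finite_branch[of _ d] node_in_root_leaf_path_iff[of w v "Suc j" d]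
      by (auto simp: objects_at_def)
    have "?A \<noteq> {}"
      using obj[OF w] by blast
    then have "\<exists>P\<in>?A. \<forall>Q\<in>?A. Q \<noteq> P \<longrightarrow> col Q \<noteq> col P"
      by (rule cf[unfolded conflict_free_def, rule_format])
    then obtain P where P: "P \<in> ?A" and uniq: "\<And>Q. Q \<in> ?A \<Longrightarrow> Q \<noteq> P \<Longrightarrow> col Q \<noteq> col P"
      by blast
    \<comment> \<open>The node has depth at least 1, out of reach of the padding objects.\<close>
    have "P \<notin> \<B>"
      using \<B>[of P "node w (Suc j)"] P by (auto simp: objects_at_def node_def)
    then obtain u where u: "u \<subseteq> {1..d}" "P = root_leaf_path d u"
      using P by (auto simp: objects_at_def)
    have wu: "l \<in> w \<longleftrightarrow> l \<in> u" if "l < Suc j" for l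
      using that P u w Suc.prems finite_branch[of _ d] node_in_root_leaf_path_iff[of w u "Suc j" d]
      by (auto simp: objects_at_def)
    \<comment> \<open>\<open>w'\<close> turns at depth \<open>Suc j\<close> against
      \<open>u\<close>, so paths through the child that it selects differ from \<open>P\<close> and
      avoid the color of \<open>P\<close> too.\<close>
    define w' where "w' = (if Suc j \<in> u then w - {Suc j} else insert (Suc j) w)"
    have w': "w' \<subseteq> {1..d}" "Suc j \<in> w' \<longleftrightarrow> Suc j \<notin> u" "\<And>l. l < Suc j \<Longrightarrow> l \<in> w' \<longleftrightarrow> l \<in> w"
      using w Suc.prems by (auto simp: w'_def)
    have "finite C"
      using C by (rule_tac finite_subset[of _ ?C]) auto
    moreover have "col P \<notin> C"
      using avoid[of u] u wu by blast
    ultimately have "card (insert (col P) C) = Suc j"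
      using C by simp
    moreover have "insert (col P) C \<subseteq> ?C"
      using C u by auto
    moreover have "\<forall>v. v \<subseteq> {1..d} \<and> (\<forall>l<Suc (Suc j). l \<in> w' \<longleftrightarrow> l \<in> v) \<longrightarrow>
        col (root_leaf_path d v) \<notin> insert (col P) C"
    proof (intro allI impI)
      fix v
      assume v: "v \<subseteq> {1..d} \<and> (\<forall>l<Suc (Suc j). l \<in> w' \<longleftrightarrow> l \<in> v)"
      have wv: "l \<in> w \<longleftrightarrow> l \<in> v" if "l < Suc j" for l
        using v w' that by (metis less_SucI)
      have "v \<noteq> u"
        using v w' by blast
      then have "root_leaf_path d v \<noteq> P"
        using inj_onD[OF inj_on_root_leaf_path, of d v u] u v by auto
      then have "col (root_leaf_path d v) \<noteq> col P"
        using uniq[OF obj[OF _ wv]] v by simp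
      then show "col (root_leaf_path d v) \<notin> insert (col P) C"
        using avoid[OF _ wv] v by simp
    qed
    ultimately show ?case
      using w'(1) by (intro exI[of _ w'] exI[of _ "insert (col P) C"] conjI) simp_all
  qed
  from step[OF order_refl] obtain w C where w: "w \<subseteq> {1..d}" "C \<subseteq> ?C" "card C = d"
    and avoid: "\<forall>v. v \<subseteq> {1..d} \<and> (\<forall>l<Suc d. l \<in> w \<longleftrightarrow> l \<in> v) \<longrightarrow>
      col (root_leaf_path d v) \<notin> C"
    by (elim exE conjE)
  \<comment> \<open>At the leaf, the color of the path ending there is one more beyond the
    \<open>d\<close> collected colors.\<close>
  have "col (root_leaf_path d w) \<notin> C"
    using w(1) by (intro avoid[rule_format]) simp
  have "finite C"
    using w(2) by (rule finite_subset) simp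
  with \<open>col (root_leaf_path d w) \<notin> C\<close> have "Suc d = card (insert (col (root_leaf_path d w)) C)"
    using w by simp
  also have "\<dots> \<le> card ?C"
    using w by (intro card_mono) auto
  finally show ?thesis .
qed

text \<open>One-point paths at distinct positions inside the additional edge bring the number of
  objects to exactly \<open>n\<close>, the form that \<open>cf_colors_suffice\<close> asks
  for.\<close>

lemma paths_needing_many_colors:
  assumes k: "2 ^ Suc d \<le> k" and n: "2 ^ d \<le> n"
  shows "\<exists>(T :: (real \<times> real) topology) \<A>. tree_space_leaves_le T k \<and> finite \<A> \<and> card \<A> = n \<and>
    (\<forall>P\<in>\<A>. tree_path T P) \<and>
    (\<forall>col :: (real \<times> real) set \<Rightarrow> 'c. conflict_free \<A> col \<longrightarrow> Suc d \<le> card (col ` \<A>))"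
proof -
  have "infinite {0<..<1::real}"
    by simp
  then obtain Z where Z: "finite Z" "card Z = n - 2 ^ d" "Z \<subseteq> {0<..<1::real}"
    using infinite_arbitrarily_large by blast
  define \<B> where "\<B> = (\<lambda>x. branch_graph {} {x..x}) ` Z"
  define \<A> where "\<A> = root_leaf_path d ` Pow {1..d} \<union> \<B>"
  have small: "fst p < 1" if "Q \<in> \<B>" "p \<in> Q" for Q p
    using that Z by (auto simp: \<B>_def branch_graph_def)
  have "inj_on (\<lambda>x. branch_graph {} {x..x}) Z"
    by (auto simp: inj_on_def branch_graph_def)
  then have cB: "card \<B> = n - 2 ^ d" "finite \<B>"
    using Z by (auto simp: \<B>_def card_image)
  \<comment> \<open>A point at depth \<open>Suc d\<close> tells a root-to-leaf path from every
    padding object.\<close>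
  have "node w (Suc d) \<in> root_leaf_path d w" for w
    by (auto simp: node_def root_leaf_path_def branch_graph_def)
  then have disj: "root_leaf_path d ` Pow {1..d} \<inter> \<B> = {}"
    using small by (fastforce simp: node_def)
  have fin: "finite \<A>"
    using cB by (simp add: \<A>_def)
  have "card \<A> = n"
    using cB n disj card_image[OF inj_on_root_leaf_path[of d]]
    by (simp add: \<A>_def card_Un_disjoint card_Pow)
  moreover have "tree_path (tree_top d) P" if "P \<in> \<A>" for P
    using that unfolding \<A>_def
  proof
    assume "P \<in> \<B>"
    then obtain x where x: "P = branch_graph {} {x..x}" "0 < x" "x < 1"
      using Z by (auto simp: \<B>_def)
    show ?thesis
      unfolding x(1) using x by (intro tree_path_branch_graph) auto
  next
    assume "P \<in> root_leaf_path d ` Pow {1..d}"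
    then show ?thesis
      by (auto simp: root_leaf_path_def intro!: tree_path_branch_graph)
  qed
  moreover have "Suc d \<le> card (col ` \<A>)" if "conflict_free \<A> col" for col :: "(real \<times> real) set \<Rightarrow> 'c"
  proof -
    have "Suc d \<le> card (col ` root_leaf_path d ` Pow {1..d})"
      using conflict_free_colors that small by (metis \<A>_def)
    also have "\<dots> \<le> card (col ` \<A>)"
      using fin by (intro card_mono) (auto simp: \<A>_def)
    finally show ?thesis .
  qed
  ultimately show ?thesis
    using fin tree_space_leaves_le_tree[OF k] by blast
qed

section \<open>The one-point tree space and the final bound\<close>

text \<open>A single node without edges has degree 0 and is not counted as a leaf. This space, with
  no objects, serves the case where the claimed bound is 0.\<close>

lemma tree_space_leaves_le_singleton:
  fixes p :: "'a :: topological_space"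
  shows "tree_space_leaves_le (top_of_set {p}) k"
proof -
  have "openin (top_of_set {p}) U \<longleftrightarrow> U \<subseteq> {p}" for U
    using openin_subset[of "top_of_set {p}" U] openin_topspace[of "top_of_set {p}"]
    by (auto simp: subset_singleton_iff)
  then have "network_space (top_of_set {p}) {p} {}"
    by (simp add: network_space_def)
  moreover have "graph_is_tree {p} {}"
    by (auto simp: graph_is_tree_def graph_connected_def graph_cycle_def)
  moreover have "card (graph_leaves {p} {}) \<le> k"
    by (simp add: graph_leaves_def)
  ultimately show ?thesis
    unfolding tree_space_leaves_le_def by blast
qed

theorem theorem3:
  fixes n k :: nat
  assumes "n \<ge> 1" and "k \<ge> 1"
  shows "(\<exists>(T :: (real \<times> real) topology) \<A>.
            tree_space_leaves_le T k \<and>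
            finite \<A> \<and> card \<A> \<le> n \<and> (\<forall>P\<in>\<A>. tree_path T P) \<and>
            (\<forall>col :: (real \<times> real) set \<Rightarrow> nat. conflict_free \<A> col \<longrightarrow>
               int (card (col ` \<A>)) \<ge> \<lfloor>log 2 (real (min k n))\<rfloor>))
       \<and> int (chi_CF_tree_paths k n) \<ge> \<lfloor>log 2 (real (min k n))\<rfloor>"
proof -
  define r where "r = nat \<lfloor>log 2 (real (min k n))\<rfloor>"
  have m: "1 \<le> real (min k n)"
    using assms by simp
  then have log: "\<lfloor>log 2 (real (min k n))\<rfloor> = int r"
    by (simp add: r_def zero_le_log_cancel_iff)
  then have "real r \<le> log 2 (real (min k n))"
    by linarith
  then have "2 ^ r \<le> real (min k n)"
    using m by (simp add: le_log_iff powr_realpow)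
  then have "real (2 ^ r) \<le> real (min k n)"
    by simp
  then have pow: "2 ^ r \<le> min k n"
    by linarith
  show ?thesis
  proof (cases r)
    case 0
    then show ?thesis
      unfolding log using tree_space_leaves_le_singleton[of "(0, 0) :: real \<times> real" k]
      by (intro conjI exI[of _ "top_of_set {(0, 0)}"] exI[of _ "{}"]) auto
  next
    case (Suc d)
    \<comment> \<open>Depth \<open>d = r - 1\<close> is chosen so that the \<open>d + 1\<close>
      forced colors are \<open>r\<close> and the leaf bound \<open>2 ^ Suc d\<close> is
      \<open>2 ^ r\<close>.\<close>
    then have kn: "2 ^ Suc d \<le> k" "2 ^ d \<le> n"
      using pow by auto
    obtain T :: "(real \<times> real) topology" and \<A> where T: "tree_space_leaves_le T k"
      and \<A>: "finite \<A>" "card \<A> = n" "\<forall>P\<in>\<A>. tree_path T P"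
      and many: "\<And>col :: (real \<times> real) set \<Rightarrow> nat. conflict_free \<A> col \<Longrightarrow> r \<le> card (col ` \<A>)"
      using paths_needing_many_colors[OF kn, where 'c = nat] Suc by metis
    \<comment> \<open>The minimum is attained, so this particular instance has a conflict-free
      coloring with that many colors, which must be at least \<open>r\<close>.\<close>
    have "\<exists>col :: (real \<times> real) set \<Rightarrow> nat.
        conflict_free \<A> col \<and> card (col ` \<A>) \<le> chi_CF_tree_paths k n"
      by (rule cf_colors_suffice_chi[of k n, unfolded cf_colors_suffice_def, rule_format, of T])
        (intro conjI T \<A>)
    then have "r \<le> chi_CF_tree_paths k n"
      using many order_trans by blast
    then show ?thesis
      unfolding log using T \<A> many by (intro conjI exI[of _ T] exI[of _ \<A>] allI impI) simp_all
  qed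
qed

end
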